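(* Let $|\Phi\rangle \in \mathbb{C}^2\otimes\mathbb{C}^2$ be a normalized pure two-qubit state, and let $\mathbb{P}(1)_\Phi$ denote the probability of obtaining outcome $1$ when measuring the ancilla at the output of the swap test circuit with input $|\Phi\rangle\otimes|0\rangle$. Then the concurrence $C(\Phi)$ satisfies $$C(\Phi)\ \ge\ f\big(\mathbb{P}(1)_\Phi\big),$$ where $f:[0,1]\to\mathbb{R}$ is defined by $f(x)=0$ for $x\le \frac12$ and $f(x)=2x-1$ for $x>\frac12$.
   Context: Write $|\Phi\rangle=\alpha|00\rangle+\gamma|10\rangle+\delta|01\rangle+\beta|11\rangle$ with $\alpha,\beta,\gamma,\delta\in\mathbb{C}$ and $|\alpha|^2+|\beta|^2+|\gamma|^2+|\delta|^2=1$. The concurrence is $C(\Phi):=2|\alpha\beta-\gamma\delta|$. The swap test circuit acts on $\mathbb{C}^2\otimes\mathbb{C}^2\otimes\mathbb{C}^2$. The first two factors are the target qubits and the third is the ancilla. The circuit implements the unitary $U_{\mathrm{SWAP}} = (\mathbb{1}\otimes H)\, U_{\mathrm{CSWAP}}\, (\mathbb{1}\otimes H)$, where: - $\mathbb{1}$ is the identity on $\mathbb{C}^2\otimes\mathbb{C}^2$; - $H=\frac{1}{\sqrt2}\begin{pmatrix}1&1\\1&-1\end{pmatrix}$ is the Hadamard gate, acting on the ancilla; - $U_{\mathrm{CSWAP}}=\mathbb{1}\otimes|0\rangle\langle 0| + S\otimes |1\rangle\langle 1|$, with $S$ the swap operator $S(|u\rangle\otimes|v\rangle)=|v\rangle\otimes|u\rangle$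 on $\mathbb{C}^2\otimes\mathbb{C}^2$. The probability is $\mathbb{P}(1)_\Phi = \mathrm{Tr}\left[(\mathbb{1}\otimes|1\rangle\langle1|)\,U_{\mathrm{SWAP}}(|\Phi\rangle\langle\Phi|\otimes|0\rangle\langle0|)U_{\mathrm{SWAP}}^\dagger\right]$. *)

theory Defs
  imports "HOL-Analysis.Analysis"
begin

(* Index type of a qubit: the two-element type 2, with elements 0 and 1 (note that 2 = 0 there, so
   the list-based "vector [a, b]" would put b at index 0).  Tensor factors correspond to
   product index types, so that C^2 (x) C^2 (x) C^2 is complex ^ ((2 \<times> 2) \<times> 2), the
   outer second component being the ancilla. *)

definition ket :: "'n::finite \<Rightarrow> complex ^ 'n" where
  "ket i = axis i 1"

definition ketbra :: "complex ^ 'm::finite \<Rightarrow> complex ^ 'n::finite \<Rightarrow> complex ^ 'n ^ 'm" where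
  "ketbra u v = (\<chi> i j. u $ i * cnj (v $ j))"

definition adjoint_mat :: "complex ^ 'n::finite ^ 'm::finite \<Rightarrow> complex ^ 'm ^ 'n" where
  "adjoint_mat A = (\<chi> i j. cnj (A $ j $ i))"

definition tensor_vec ::
    "complex ^ 'm::finite \<Rightarrow> complex ^ 'n::finite \<Rightarrow> complex ^ ('m \<times> 'n)" where
  "tensor_vec u v = (\<chi> p. u $ fst p * v $ snd p)"

definition tensor_mat ::
    "complex ^ 'a::finite ^ 'b::finite \<Rightarrow> complex ^ 'c::finite ^ 'd::finite
      \<Rightarrow> complex ^ ('a \<times> 'c) ^ ('b \<times> 'd)" where
  "tensor_mat A B = (\<chi> p q. A $ fst p $ fst q * B $ snd p $ snd q)"

definition hadamard :: "complex ^ 2 ^ 2" where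
  "hadamard = (1 / sqrt 2) *\<^sub>R (\<chi> i j. if i = 1 \<and> j = 1 then - 1 else 1)"

(* Characterised by swap_op (u (x) v) = v (x) u: see swap_op_tensor below. *)
definition swap_op :: "complex ^ (2 \<times> 2) ^ (2 \<times> 2)" where
  "swap_op = (\<chi> p q. if fst p = snd q \<and> snd p = fst q then 1 else 0)"

definition U_CSWAP :: "complex ^ ((2 \<times> 2) \<times> 2) ^ ((2 \<times> 2) \<times> 2)" where
  "U_CSWAP = tensor_mat (mat 1) (ketbra (ket 0) (ket 0))
           + tensor_mat swap_op (ketbra (ket 1) (ket 1))"

definition U_SWAP :: "complex ^ ((2 \<times> 2) \<times> 2) ^ ((2 \<times> 2) \<times> 2)" where
  "U_SWAP = tensor_mat (mat 1) hadamard ** U_CSWAP ** tensor_mat (mat 1) hadamard"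

definition swap_test_trace :: "complex ^ (2 \<times> 2) \<Rightarrow> complex" where
  "swap_test_trace \<Phi> =
     trace (tensor_mat (mat 1) (ketbra (ket 1) (ket 1))
            ** (U_SWAP ** tensor_mat (ketbra \<Phi> \<Phi>) (ketbra (ket 0) (ket 0))
                ** adjoint_mat U_SWAP))"

(* The trace is real: see of_real_swap_test_prob below. *)
definition swap_test_prob :: "complex ^ (2 \<times> 2) \<Rightarrow> real" where
  "swap_test_prob \<Phi> = Re (swap_test_trace \<Phi>)"

definition concurrence :: "complex ^ (2 \<times> 2) \<Rightarrow> real" where
  "concurrence \<Phi> =
     (let \<alpha> = \<Phi> $ (0, 0); \<gamma> = \<Phi> $ (1, 0); \<delta> = \<Phi> $ (0, 1); \<beta> = \<Phi> $ (1, 1)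
      in 2 * cmod (\<alpha> * \<beta> - \<gamma> * \<delta>))"

(* Only its values on [0, 1] matter, by swap_test_prob_bounds below. *)
definition f_bound :: "real \<Rightarrow> real" where
  "f_bound x = (if x \<le> 1 / 2 then 0 else 2 * x - 1)"

lemma UNIV_2_01: "(UNIV :: 2 set) = {0, 1}"
  using UNIV_2 by auto

lemma sum_2_01: "sum g (UNIV :: 2 set) = g 0 + g 1"
  by (simp add: UNIV_2_01)

lemma sum_UNIV_prod:
  "sum g (UNIV :: ('a::finite \<times> 'b::finite) set) = (\<Sum>i\<in>UNIV. \<Sum>j\<in>UNIV. g (i, j))"
  by (simp add: sum.cartesian_product)

lemma forall_2_01: "(\<forall>i::2. P i) \<longleftrightarrow> P 0 \<and> P 1"
  using UNIV_2_01 by (metis UNIV_I insertE singletonD)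

lemma swap_op_tensor: "swap_op *v tensor_vec u v = tensor_vec v u"
  by (simp add: vec_eq_iff matrix_vector_mult_def swap_op_def tensor_vec_def sum_UNIV_prod
      sum_2_01 forall_2_01)

lemma tensor_ket: "tensor_vec (ket i) (ket j) = ket (i, j)"
  by (auto simp: vec_eq_iff tensor_vec_def ket_def axis_def)

lemma expand_state:
  "\<Phi> = \<Phi> $ (0, 0) *s ket (0, 0) + \<Phi> $ (1, 0) *s ket (1, 0) + \<Phi> $ (0, 1) *s ket (0, 1)
      + \<Phi> $ (1, 1) *s ket (1, 1)" for \<Phi> :: "complex ^ (2 \<times> 2)"
  by (simp add: vec_eq_iff ket_def axis_def forall_2_01)

lemma norm_state:
  "norm \<Phi> = 1 \<longleftrightarrow> (cmod (\<Phi> $ (0, 0)))\<^sup>2 + (cmod (\<Phi> $ (1, 1)))\<^sup>2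
      + (cmod (\<Phi> $ (1, 0)))\<^sup>2 + (cmod (\<Phi> $ (0, 1)))\<^sup>2 = 1" for \<Phi> :: "complex ^ (2 \<times> 2)"
  by (simp add: norm_vec_def L2_set_def sum_UNIV_prod sum_2_01 add_ac)

lemma tensor_ketbra:
  "tensor_mat (ketbra a b) (ketbra c d) = ketbra (tensor_vec a c) (tensor_vec b d)"
  by (simp add: vec_eq_iff tensor_mat_def ketbra_def tensor_vec_def)

lemma tensor_mat_vec: "tensor_mat A B *v tensor_vec u v = tensor_vec (A *v u) (B *v v)"
proof -
  have "(\<Sum>j\<in>UNIV. A $ a $ fst j * B $ b $ snd j * (u $ fst j * v $ snd j))
      = (\<Sum>j\<in>UNIV. A $ a $ j * u $ j) * (\<Sum>j\<in>UNIV. B $ b $ j * v $ j)" for a b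
    by (simp add: sum_UNIV_prod sum_product mult_ac)
  then show ?thesis
    by (simp add: vec_eq_iff tensor_mat_def tensor_vec_def matrix_vector_mult_def)
qed

lemma matrix_ketbra: "A ** ketbra u v = ketbra (A *v u) v"
  by (simp add: vec_eq_iff matrix_matrix_mult_def matrix_vector_mult_def ketbra_def
      sum_distrib_left sum_distrib_right mult_ac)

lemma ketbra_adjoint: "ketbra u v ** adjoint_mat A = ketbra u (A *v v)"
  by (simp add: vec_eq_iff matrix_matrix_mult_def matrix_vector_mult_def ketbra_def adjoint_mat_def
      sum_distrib_left mult_ac)

lemma trace_projected_conj:
  fixes U :: "complex ^ ('a::finite \<times> 2) ^ ('a \<times> 2)"
  shows "trace (tensor_mat (mat 1) (ketbra (ket 1) (ket 1))
            ** (U ** tensor_mat (ketbra \<Phi> \<Phi>) (ketbra (ket 0) (ket 0)) ** adjoint_mat U))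
       = of_real (\<Sum>i\<in>UNIV. (cmod ((U *v tensor_vec \<Phi> (ket 0)) $ (i, 1)))\<^sup>2)"
proof -
  define w where "w = U *v tensor_vec \<Phi> (ket 0)"
  have *: "(tensor_mat (mat 1) (ketbra (ket 1) (ket 1)) *v w) $ (i, j) = (if j = 1 then w $ (i, 1) else 0)"
    for i j
  proof -
    have "(\<Sum>x\<in>UNIV. (if i = x then 1 else 0) * w $ (x, 1)) = w $ (i, 1)"
      by (subst sum.cong[OF refl, of _ _ "\<lambda>x. if i = x then w $ (x, 1) else 0"]) auto
    then show ?thesis
      by (simp add: tensor_mat_def matrix_vector_mult_def ketbra_def ket_def axis_def mat_def
          sum_UNIV_prod sum_2_01)
  qed
  have "trace (tensor_mat (mat 1) (ketbra (ket 1) (ket 1)) ** ketbra w w)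
      = (\<Sum>i\<in>UNIV. w $ (i, 1) * cnj (w $ (i, 1)))"
    unfolding matrix_ketbra by (simp add: trace_def ketbra_def[of _ w] * sum_UNIV_prod sum_2_01)
  then show ?thesis
    unfolding tensor_ketbra matrix_ketbra ketbra_adjoint w_def[symmetric]
    by (simp only: complex_norm_square of_real_sum)
qed

lemma U_CSWAP_tensor:
  "U_CSWAP *v tensor_vec \<Phi> v
     = tensor_vec \<Phi> (v $ 0 *s ket 0) + tensor_vec (swap_op *v \<Phi>) (v $ 1 *s ket 1)"
proof -
  have "ketbra (ket i) (ket i) *v v = v $ i *s ket i" for i :: 2
    by (simp add: vec_eq_iff ketbra_def ket_def axis_def matrix_vector_mult_def forall_2_01
        sum_2_01)
  then show ?thesis
    by (simp add: U_CSWAP_def matrix_vector_mult_add_rdistrib tensor_mat_vec)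
qed

lemma U_SWAP_out1:
  "(U_SWAP *v tensor_vec \<Phi> (ket 0)) $ ((i, j), 1) = (\<Phi> $ (i, j) - \<Phi> $ (j, i)) / 2"
proof -
  have had: "hadamard $ i $ j = (if i = 1 \<and> j = 1 then - 1 else 1) / sqrt 2" for i j
    unfolding hadamard_def vector_scaleR_component by (simp add: scaleR_conv_of_real)
  have h0: "(hadamard *v ket 0) $ k = 1 / sqrt 2" for k
    by (simp add: had matrix_vector_mult_def ket_def axis_def sum_2_01)
  have h1: "(hadamard *v (c *s ket 0)) $ 1 = c / sqrt 2" "(hadamard *v (c *s ket 1)) $ 1 = - c / sqrt 2" for c
    by (simp_all add: had matrix_vector_mult_def ket_def axis_def sum_2_01)
  have sw: "(swap_op *v \<Phi>) $ (i, j) = \<Phi> $ (j, i)" for i j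
  proof -
    have "\<forall>i j. (swap_op *v \<Phi>) $ (i, j) = \<Phi> $ (j, i)"
      by (simp add: matrix_vector_mult_def swap_op_def sum_UNIV_prod sum_2_01 forall_2_01)
    then show ?thesis by blast
  qed
  have r: "complex_of_real (sqrt 2) * complex_of_real (sqrt 2) = 2"
    by (metis of_real_mult of_real_numeral real_sqrt_mult_self abs_numeral)
  have "U_SWAP *v tensor_vec \<Phi> (ket 0)
      = tensor_vec \<Phi> (hadamard *v ((1 / sqrt 2) *s ket 0))
      + tensor_vec (swap_op *v \<Phi>) (hadamard *v ((1 / sqrt 2) *s ket 1))"
    by (simp add: U_SWAP_def matrix_vector_mul_assoc[symmetric] tensor_mat_vec U_CSWAP_tensor h0
        matrix_vector_right_distrib)
  then show ?thesis
    by (simp add: tensor_vec_def h1 sw r diff_divide_distrib)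
qed

lemma swap_test_trace_eq:
  "swap_test_trace \<Phi> = of_real ((cmod (\<Phi> $ (1, 0) - \<Phi> $ (0, 1)))\<^sup>2 / 2)"
  unfolding swap_test_trace_def trace_projected_conj
  by (simp add: sum_UNIV_prod sum_2_01 U_SWAP_out1 norm_divide power_divide norm_minus_commute)

lemma of_real_swap_test_prob: "of_real (swap_test_prob \<Phi>) = swap_test_trace \<Phi>"
  by (simp only: swap_test_prob_def swap_test_trace_eq Re_complex_of_real)

lemma swap_test_prob_bounds:
  assumes "norm \<Phi> = 1"
  shows "swap_test_prob \<Phi> \<in> {0..1}"
proof -
  let ?x = "cmod (\<Phi> $ (1, 0))" and ?y = "cmod (\<Phi> $ (0, 1))"
  have "(cmod (\<Phi> $ (1, 0) - \<Phi> $ (0, 1)))\<^sup>2 \<le> (?x + ?y)\<^sup>2"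
    by (intro power_mono norm_triangle_ineq4) auto
  also have "\<dots> \<le> 2 * (?x\<^sup>2 + ?y\<^sup>2)"
    using sum_squares_bound[of ?x ?y] by (simp add: power2_sum)
  also have "?x\<^sup>2 + ?y\<^sup>2 \<le> 1"
    using assms unfolding norm_state
    by (smt (verit) zero_le_power2)
  finally have "(cmod (\<Phi> $ (1, 0) - \<Phi> $ (0, 1)))\<^sup>2 \<le> 2" by simp
  moreover have "swap_test_prob \<Phi> = (cmod (\<Phi> $ (1, 0) - \<Phi> $ (0, 1)))\<^sup>2 / 2"
    unfolding swap_test_prob_def swap_test_trace_eq by (simp only: Re_complex_of_real)
  ultimately show ?thesis
    using zero_le_power2[of "cmod (\<Phi> $ (1, 0) - \<Phi> $ (0, 1))"]
    unfolding atLeastAtMost_iff by linarith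
qed

end

theory Submission
  imports Defs
begin

text \<open>The outcome probability is half of \<open>\<bar>\<gamma> - \<delta>\<bar>\<^sup>2\<close>, and
  \<open>2 \<bar>\<alpha>\<beta> - \<gamma>\<delta>\<bar> \<ge> 2 \<bar>\<gamma>\<bar> \<bar>\<delta>\<bar> - 2 \<bar>\<alpha>\<bar> \<bar>\<beta>\<bar>\<close>. By AM-GM and normalisation
  \<open>2 \<bar>\<alpha>\<bar> \<bar>\<beta>\<bar> \<le> 1 - \<bar>\<gamma>\<bar>\<^sup>2 - \<bar>\<delta>\<bar>\<^sup>2\<close>, so the right-hand side is at least
  \<open>(\<bar>\<gamma>\<bar> + \<bar>\<delta>\<bar>)\<^sup>2 - 1 \<ge> \<bar>\<gamma> - \<delta>\<bar>\<^sup>2 - 1\<close>.\<close>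

text \<open>Outcome 1 leaves the antisymmetric part of \<Phi>, whose only nonzero entries are
  (\<gamma> - \<delta>)/2 and its negative; their squared moduli add up to this value.\<close>

lemma swap_test_prob_eq: "swap_test_prob \<Phi> = (cmod (\<Phi> $ (1, 0) - \<Phi> $ (0, 1)))\<^sup>2 / 2"
  unfolding swap_test_prob_def swap_test_trace_eq by (simp only: Re_complex_of_real)

theorem theorem2:
  fixes \<Phi> :: "complex ^ (2 \<times> 2)"
  assumes "norm \<Phi> = 1"
  shows "concurrence \<Phi> \<ge> f_bound (swap_test_prob \<Phi>)"
proof -
  define a b c d where "a = \<Phi> $ (0, 0)" and "b = \<Phi> $ (1, 1)"
    and "c = \<Phi> $ (1, 0)" and "d = \<Phi> $ (0, 1)"
  note abcd = a_def b_def c_def d_def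
  have conc: "concurrence \<Phi> = 2 * cmod (a * b - c * d)"
    unfolding concurrence_def Let_def abcd ..
  have prob: "swap_test_prob \<Phi> = (cmod (c - d))\<^sup>2 / 2"
    unfolding swap_test_prob_eq abcd ..
  have normalized: "(cmod a)\<^sup>2 + (cmod b)\<^sup>2 + (cmod c)\<^sup>2 + (cmod d)\<^sup>2 = 1"
    using assms unfolding norm_state abcd .
  have "(cmod (c - d))\<^sup>2 \<le> (cmod c + cmod d)\<^sup>2"
    by (intro power_mono norm_triangle_ineq4) auto
  also have "\<dots> = (cmod c)\<^sup>2 + (cmod d)\<^sup>2 + 2 * (cmod c * cmod d)"
    by (simp add: power2_sum)
  also have "\<dots> \<le> 1 + 2 * (cmod c * cmod d - cmod a * cmod b)"
    using normalized sum_squares_bound[of "cmod a" "cmod b"] by simp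
  \<comment> \<open>Reverse triangle inequality, with \<open>c * d\<close> as the minuend.\<close>
  also have "\<dots> \<le> 1 + 2 * cmod (a * b - c * d)"
    using norm_triangle_ineq2[of "c * d" "a * b"]
    by (simp add: norm_mult norm_minus_commute)
  finally have "2 * swap_test_prob \<Phi> - 1 \<le> concurrence \<Phi>"
    unfolding conc prob by simp
  \<comment> \<open>\<open>f_bound x\<close> is the maximum of 0 and \<open>2 * x - 1\<close>, so
    this covers its other branch.\<close>
  moreover have "0 \<le> concurrence \<Phi>"
    unfolding conc by simp
  ultimately show ?thesis
    by (simp add: f_bound_def)
qed

end
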